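(* If an inequality $qS\ge 0$ is valid for $H_n$, then any zero-lift $q'S'\ge 0$ of it is valid for $H_{n+1}$.
   Context: For a positive integer $k$ let $[k]=\{1,\dots,k\}$. $K_N$ is the undirected complete graph on vertex set $[N]$, with edge set $E_N$. A weight map is a function $w:E_N\to\mathbb{R}_{\ge 0}$. For $W\subseteq[N]$, the cut $C(W)$ is the set of edges with exactly one endpoint in $W$, and $\|C(W)\|$ is the sum of the weights of its edges. For $1\le n<N$, $w$ realizes in $K_N$ the vector $S=(S_I)_{\varnothing\ne I\subseteq[n]}\in\mathbb{R}^{2^n-1}$ with $S_I=\min\{\|C(W)\| : W\subseteq[N-1],\ W\cap[n]=I\}$. $H_n$ is the set of all $S\in\mathbb{R}^{2^n-1}$ realized by some weight map in $K_N$ for some $N>n$. An inequality $qS\ge0$ with $q=(q_I)_{\varnothing\ne I\subseteq[n]}\in\mathbb{R}^{2^n-1}$ means $\sum_I q_IS_I\ge 0$; it is valid for $H_n$ if it holds for all $S\in H_n$. Zero-lift: let $K\subseteq[n]$ be the set of terminals appearing in $qS\ge0$ ($i\in K$ iff $q_I\neq0$ for some $I\ni i$). Given a family of pairwise disjoint non-empty subsets $I_i\subseteq[n+1]$, $i\in K$ (whose union need not be $[n+1]$), the corresponding zero-lift $q'S'\ge0$, an inequality over $\mathbb{R}^{2^{n+1}-1}$, is obtained by replacing each term $q_IS_I$ with $q_I\neq0$ by $q_IS'_{\bigcup_{i\in I}I_i}$. *)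

theory Defs
  imports Complex_Main "HOL-Library.FuncSet" "HOL-Library.Disjoint_Sets"
begin

(* Vectors in R^(2^n - 1) are extensional functions on the non-empty subsets of {1..n}. *)

definition index_sets :: "nat \<Rightarrow> nat set set" where
  "index_sets n = {I. I \<subseteq> {1..n} \<and> I \<noteq> {}}"

definition vectors :: "nat \<Rightarrow> (nat set \<Rightarrow> real) set" where
  "vectors n = index_sets n \<rightarrow>\<^sub>E UNIV"

definition edges :: "nat \<Rightarrow> nat set set" where
  "edges N = {{u, v} | u v. u \<in> {1..N} \<and> v \<in> {1..N} \<and> u \<noteq> v}"

definition weight_map :: "nat \<Rightarrow> (nat set \<Rightarrow> real) \<Rightarrow> bool" where
  "weight_map N w \<longleftrightarrow> w \<in> edges N \<rightarrow>\<^sub>E {0..}"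

definition cut :: "nat \<Rightarrow> nat set \<Rightarrow> nat set set" where
  "cut N W = {e \<in> edges N. card (e \<inter> W) = 1}"

definition cut_weight :: "nat \<Rightarrow> (nat set \<Rightarrow> real) \<Rightarrow> nat set \<Rightarrow> real" where
  "cut_weight N w W = (\<Sum>e\<in>cut N W. w e)"

(* For n < N and I in index_sets n the minimum is over a finite non-empty set
   (the choice W = I is admissible), so Min is the genuine minimum. *)
definition realizes :: "nat \<Rightarrow> nat \<Rightarrow> (nat set \<Rightarrow> real) \<Rightarrow> (nat set \<Rightarrow> real) \<Rightarrow> bool" where
  "realizes N n w S \<longleftrightarrow> S \<in> vectors n \<and>
     (\<forall>I\<in>index_sets n.
        S I = Min {cut_weight N w W | W. W \<subseteq> {1..N - 1} \<and> W \<inter> {1..n} = I})"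

definition H :: "nat \<Rightarrow> (nat set \<Rightarrow> real) set" where
  "H n = {S. \<exists>N>n. \<exists>w. weight_map N w \<and> realizes N n w S}"

definition valid_ineq :: "nat \<Rightarrow> (nat set \<Rightarrow> real) \<Rightarrow> bool" where
  "valid_ineq n q \<longleftrightarrow> (\<forall>S\<in>H n. (\<Sum>I\<in>index_sets n. q I * S I) \<ge> 0)"

definition terminals :: "nat \<Rightarrow> (nat set \<Rightarrow> real) \<Rightarrow> nat set" where
  "terminals n q = {i \<in> {1..n}. \<exists>I\<in>index_sets n. i \<in> I \<and> q I \<noteq> 0}"

(* F i plays the role of the set I_i. The coefficient of S'_J collects the terms
   q_I S_I with q_I nonzero whose index is sent to J. *)
definition zero_lift_by ::
  "nat \<Rightarrow> (nat \<Rightarrow> nat set) \<Rightarrow> (nat set \<Rightarrow> real) \<Rightarrow> nat set \<Rightarrow> real" where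
  "zero_lift_by n F q =
     (\<lambda>J\<in>index_sets (n + 1). \<Sum>I | I \<in> index_sets n \<and> q I \<noteq> 0 \<and> (\<Union>i\<in>I. F i) = J. q I)"

definition is_zero_lift :: "nat \<Rightarrow> (nat set \<Rightarrow> real) \<Rightarrow> (nat set \<Rightarrow> real) \<Rightarrow> bool" where
  "is_zero_lift n q q' \<longleftrightarrow>
     (\<exists>F. (\<forall>i\<in>terminals n q. F i \<subseteq> {1..n + 1} \<and> F i \<noteq> {}) \<and>
          disjoint_family_on F (terminals n q) \<and>
          q' = zero_lift_by n F q)"

lemma finite_index_sets: "finite (index_sets n)"
  unfolding index_sets_def by (rule finite_subset[of _ "Pow {1..n}"]) auto

(* The linear form of the zero-lift is obtained by term-by-term substitution. *)
lemma zero_lift_by_sum: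
  assumes F: "\<forall>i\<in>terminals n q. F i \<subseteq> {1..n + 1} \<and> F i \<noteq> {}"
  shows "(\<Sum>J\<in>index_sets (n + 1). zero_lift_by n F q J * S J) =
    (\<Sum>I | I \<in> index_sets n \<and> q I \<noteq> 0. q I * S (\<Union>i\<in>I. F i))"
proof -
  let ?A = "{I. I \<in> index_sets n \<and> q I \<noteq> 0}"
  let ?g = "\<lambda>I. \<Union>i\<in>I. F i"
  have img: "?g I \<in> index_sets (n + 1)" if "I \<in> ?A" for I
  proof -
    have "I \<subseteq> terminals n q" "I \<noteq> {}"
      using that by (auto simp: terminals_def index_sets_def)
    then show ?thesis
      using F unfolding index_sets_def by blast
  qed
  have fin: "finite ?A"
    by (simp add: finite_index_sets)
  have "(\<Sum>J\<in>index_sets (n + 1). zero_lift_by n F q J * S J) =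
      (\<Sum>J\<in>index_sets (n + 1). \<Sum>I | I \<in> ?A \<and> ?g I = J. q I * S (?g I))"
    by (intro sum.cong refl) (simp add: zero_lift_by_def sum_distrib_right conj_assoc)
  also have "\<dots> = (\<Sum>I\<in>?A. q I * S (?g I))"
    using sum.group[OF fin finite_index_sets, of ?g "n + 1" "\<lambda>I. q I * S (?g I)"] img
    by blast
  finally show ?thesis .
qed

end

theory Submission
  imports Defs
begin

text \<open>
  Given a realization of \<open>S'\<close> in \<open>K\<^sub>N\<close>, contract each \<open>I\<^sub>i\<close> to the single terminal \<open>i\<close> and all
  terminals of \<open>[n + 1]\<close> lying in no \<open>I\<^sub>i\<close> to the sink \<open>N\<close>. The cuts of the contracted graph that
  separate a set \<open>I\<close> of appearing terminals are exactly the cuts of the original graph that separate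
  \<open>\<Union>i\<in>I. I\<^sub>i\<close>, with the same weights. Hence the contracted graph realizes a vector \<open>S\<close>
  whose entry at each such \<open>I\<close> is the entry of \<open>S'\<close> at that union, and \<open>q'S' = qS \<ge> 0\<close>.
\<close>

text \<open>The push-forward of \<open>w\<close> along the vertex map \<open>f\<close>. The vertex
  set stays \<open>{1..N}\<close>, so nothing is relabelled: vertices not hit by \<open>f\<close>
  become isolated, and edges collapsed to a singleton are dropped because their image is not in
  \<open>edges N\<close>.\<close>

definition contract :: "nat \<Rightarrow> (nat \<Rightarrow> nat) \<Rightarrow> (nat set \<Rightarrow> real) \<Rightarrow> nat set \<Rightarrow> real" where
  "contract N f w = (\<lambda>e'\<in>edges N. \<Sum>e | e \<in> edges N \<and> f ` e = e'. w e)"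

lemma finite_edges: "finite (edges N)"
  by (rule finite_subset[of _ "Pow {1..N}"]) (auto simp: edges_def)

lemma weight_map_contract:
  assumes "weight_map N w"
  shows "weight_map N (contract N f w)"
  using assms by (auto simp: weight_map_def contract_def intro!: sum_nonneg)

text \<open>The case \<open>u = v\<close> is included on purpose: the image of a collapsed edge is
  such a degenerate pair, and it lies in no cut.\<close>

lemma pair_in_cut_iff:
  assumes "u \<in> {1..N}" "v \<in> {1..N}"
  shows "{u, v} \<in> cut N W \<longleftrightarrow> (u \<in> W) \<noteq> (v \<in> W)"
proof (cases "u = v")
  case True
  then show ?thesis
    by (auto simp: cut_def edges_def doubleton_eq_iff)
next
  case False
  then show ?thesis
    using assms by (auto simp: cut_def edges_def Int_insert_left)
qed

lemma image_in_cut_iff: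
  assumes f: "f \<in> {1..N} \<rightarrow> {1..N}" and e: "e \<in> edges N"
  shows "f ` e \<in> cut N W \<longleftrightarrow> e \<in> cut N {v \<in> {1..N}. f v \<in> W}"
proof -
  obtain u v where uv: "e = {u, v}" "u \<in> {1..N}" "v \<in> {1..N}"
    using e by (auto simp: edges_def)
  moreover have "f u \<in> {1..N}" "f v \<in> {1..N}"
    using f uv by blast+
  ultimately show ?thesis
    by (simp add: pair_in_cut_iff del: atLeastAtMost_iff)
qed

text \<open>The edges that \<open>f\<close> sends into \<open>cut N W\<close> are exactly those of
  the pulled-back cut. Grouping them by their image counts each one once.\<close>

lemma cut_weight_contract:
  assumes f: "f \<in> {1..N} \<rightarrow> {1..N}"
  shows "cut_weight N (contract N f w) W = cut_weight N w {v \<in> {1..N}. f v \<in> W}"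
proof -
  let ?V = "{v \<in> {1..N}. f v \<in> W}"
  have sub: "cut N X \<subseteq> edges N" for X
    by (auto simp: cut_def)
  then have fin: "finite (cut N X)" for X
    using finite_edges finite_subset by blast
  have "cut_weight N (contract N f w) W =
      (\<Sum>e'\<in>cut N W. \<Sum>e | e \<in> edges N \<and> f ` e = e'. w e)"
    unfolding cut_weight_def contract_def using sub by (intro sum.cong) auto
  also have "\<dots> = (\<Sum>e'\<in>cut N W. \<Sum>e | e \<in> cut N ?V \<and> f ` e = e'. w e)"
    using image_in_cut_iff[OF f] sub by (intro sum.cong refl Collect_cong) blast
  also have "\<dots> = cut_weight N w ?V"
    unfolding cut_weight_def
    by (rule sum.group[OF fin fin]) (use image_in_cut_iff[OF f] sub in auto)
  finally show ?thesis .
qed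

text \<open>For disjoint blocks the \<open>THE\<close> picks the unique block containing
  \<open>v\<close>. If \<open>K \<subseteq> {1..n}\<close> and \<open>n + 1 < N\<close>, then
  \<open>n + 1\<close> and the terminals outside \<open>K\<close> are not values on
  \<open>{1..N}\<close>, so they end up isolated after contraction.\<close>

definition zero_lift_map :: "nat \<Rightarrow> nat \<Rightarrow> nat set \<Rightarrow> (nat \<Rightarrow> nat set) \<Rightarrow> nat \<Rightarrow> nat" where
  "zero_lift_map n N K F v =
     (if v \<in> {1..n + 1} then
        if \<exists>i\<in>K. v \<in> F i then THE i. i \<in> K \<and> v \<in> F i else N
      else v)"

lemma zero_lift_map_block:
  assumes "disjoint_family_on F K" "i \<in> K" "v \<in> F i" "v \<in> {1..n + 1}"
  shows "zero_lift_map n N K F v = i"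
proof -
  have "(THE j. j \<in> K \<and> v \<in> F j) = i"
    using assms by (auto simp: disjoint_family_on_def)
  then show ?thesis
    using assms by (auto simp: zero_lift_map_def)
qed

lemma zero_lift_map_outside_blocks:
  assumes "v \<in> {1..n + 1}" "v \<notin> (\<Union>i\<in>K. F i)"
  shows "zero_lift_map n N K F v = N"
  using assms by (auto simp: zero_lift_map_def)

lemma zero_lift_map_nonterminal:
  assumes "v \<notin> {1..n + 1}"
  shows "zero_lift_map n N K F v = v"
  using assms by (auto simp: zero_lift_map_def)

lemma zero_lift_map_cases:
  assumes "disjoint_family_on F K"
  obtains (block) i where "v \<in> {1..n + 1}" "i \<in> K" "v \<in> F i" "zero_lift_map n N K F v = i"
  | (outside) "v \<in> {1..n + 1}" "v \<notin> (\<Union>i\<in>K. F i)" "zero_lift_map n N K F v = N"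
  | (inner) "v \<notin> {1..n + 1}" "zero_lift_map n N K F v = v"
proof (cases "v \<in> {1..n + 1}")
  case True
  then show ?thesis
    using that(1,2) zero_lift_map_block[OF assms] zero_lift_map_outside_blocks by (metis UN_iff)
next
  case False
  then show ?thesis
    using that(3) zero_lift_map_nonterminal by simp
qed

text \<open>A preimage under the map contains each block entirely or not at all, and
  \<open>W\<close> decides which. Both inclusions matter, since the two minima are to be taken over
  the same family of cuts.\<close>

lemma zero_lift_cuts:
  assumes disj: "disjoint_family_on F K" and K: "K \<subseteq> {1..n}"
    and F: "\<And>i. i \<in> K \<Longrightarrow> F i \<subseteq> {1..n + 1}" and N: "n + 1 < N" and I: "I \<subseteq> K"
  shows "(\<lambda>W. {v \<in> {1..N}. zero_lift_map n N K F v \<in> W}) ` {W. W \<subseteq> {1..N - 1} \<and> W \<inter> {1..n} = I} =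
    {W. W \<subseteq> {1..N - 1} \<and> W \<inter> {1..n + 1} = (\<Union>i\<in>I. F i)}"
    (is "?pre ` ?A = ?B")
proof -
  let ?f = "zero_lift_map n N K F"
  have in_blocks: "v \<in> (\<Union>i\<in>I. F i) \<longleftrightarrow> i \<in> I" if "i \<in> K" "v \<in> F i" for i v
  proof
    assume "v \<in> (\<Union>i\<in>I. F i)"
    then obtain j where j: "j \<in> I" "v \<in> F j"
      by blast
    then have "j = i"
      using disjoint_family_onD[OF disj, of j i] that I by blast
    then show "i \<in> I"
      using j by simp
  qed (use that in blast)
  have "?pre ` ?A \<subseteq> ?B"
  proof
    fix V assume "V \<in> ?pre ` ?A"
    then obtain W where V: "V = ?pre W" and W: "W \<subseteq> {1..N - 1}" "W \<inter> {1..n} = I"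
      by blast
    have N_notin: "N \<notin> W"
      using W N by auto
    \<comment> \<open>Since \<open>n + 1 < N\<close>, the sink is not among the terminals
      \<open>{1..n + 1}\<close> and stays fixed, so the preimage avoids it as well.\<close>
    have "?f N = N"
      using N by (simp add: zero_lift_map_nonterminal)
    then have "N \<notin> V"
      using V N_notin by simp
    moreover have "V \<subseteq> {1..N}"
      using V by blast
    moreover have "{1..N} - {N} = {1..N - 1}"
      by auto
    ultimately have "V \<subseteq> {1..N - 1}"
      by blast
    moreover have "v \<in> V \<longleftrightarrow> v \<in> (\<Union>i\<in>I. F i)" if "v \<in> {1..n + 1}" for v
      using disj
    proof (cases rule: zero_lift_map_cases[of F K v n N])
      case (block i)
      have "v \<in> V \<longleftrightarrow> i \<in> W"
        using block that N V by auto
      also have "\<dots> \<longleftrightarrow> i \<in> I"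
        using block K W by blast
      also have "\<dots> \<longleftrightarrow> v \<in> (\<Union>i\<in>I. F i)"
        using in_blocks[OF block(2,3)] by simp
      finally show ?thesis .
    next
      case outside
      then show ?thesis
        using V N_notin I by auto
    next
      case inner
      then show ?thesis
        using that by blast
    qed
    moreover have "(\<Union>i\<in>I. F i) \<subseteq> {1..n + 1}"
      using F I by blast
    ultimately show "V \<in> ?B"
      by blast
  qed
  moreover have "?B \<subseteq> ?pre ` ?A"
  proof
    fix V assume "V \<in> ?B"
    then have V: "V \<subseteq> {1..N - 1}" "V \<inter> {1..n + 1} = (\<Union>i\<in>I. F i)"
      by blast+
    \<comment> \<open>Each block inside \<open>V\<close> is replaced by its terminal, and the
      vertices beyond \<open>n + 1\<close> are kept. Vertex \<open>n + 1\<close> has an empty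
      preimage, so leaving it out does not affect \<open>?pre W\<close>.\<close>
    define W where "W = I \<union> (V - {1..n + 1})"
    have "I \<subseteq> {1..n}"
      using I K by blast
    then have W: "W \<in> ?A"
      using V N unfolding W_def by fastforce
    have "?f v \<in> W \<longleftrightarrow> v \<in> V" if "v \<in> {1..N}" for v
      using disj
    proof (cases rule: zero_lift_map_cases[of F K v n N])
      case (block i)
      have "i \<in> {1..n}"
        using block K by blast
      then have "?f v \<in> W \<longleftrightarrow> i \<in> I"
        using block unfolding W_def by auto
      also have "\<dots> \<longleftrightarrow> v \<in> (\<Union>i\<in>I. F i)"
        using in_blocks[OF block(2,3)] by simp
      also have "\<dots> \<longleftrightarrow> v \<in> V"
        using block V by blast
      finally show ?thesis .
    next
      case outside
      have "N \<notin> W"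
        using W N by auto
      moreover have "v \<notin> V"
        using outside V I by blast
      ultimately show ?thesis
        using outside by simp
    next
      case inner
      then show ?thesis
        using \<open>I \<subseteq> {1..n}\<close> by (auto simp: W_def)
    qed
    moreover have "V \<subseteq> {1..N}"
      by (rule subset_trans[OF V(1)]) auto
    ultimately have "?pre W = V"
      by blast
    then show "V \<in> ?pre ` ?A"
      using W by blast
  qed
  ultimately show ?thesis by (rule subset_antisym)
qed

text \<open>The vector is realized by the contracted weights. Its entries are compared only at
  \<open>I \<subseteq> K\<close>, because the hypotheses say nothing about \<open>F\<close> outside
  \<open>K\<close>.\<close>

lemma zero_lift_preimage:
  assumes S': "S' \<in> H (n + 1)"
    and disj: "disjoint_family_on F K" and K: "K \<subseteq> {1..n}"
    and F: "\<And>i. i \<in> K \<Longrightarrow> F i \<subseteq> {1..n + 1} \<and> F i \<noteq> {}"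
  shows "\<exists>S\<in>H n. \<forall>I. I \<subseteq> K \<and> I \<noteq> {} \<longrightarrow> S I = S' (\<Union>i\<in>I. F i)"
proof -
  obtain N w where N: "n + 1 < N" and w: "weight_map N w" and r: "realizes N (n + 1) w S'"
    using S' unfolding H_def by blast
  let ?f = "zero_lift_map n N K F"
  let ?pre = "\<lambda>W. {v \<in> {1..N}. ?f v \<in> W}"
  let ?w = "contract N ?f w"
  define S where "S = (\<lambda>I\<in>index_sets n.
    Min {cut_weight N ?w W | W. W \<subseteq> {1..N - 1} \<and> W \<inter> {1..n} = I})"
  have f: "?f \<in> {1..N} \<rightarrow> {1..N}"
  proof
    fix v assume "v \<in> {1..N}"
    then show "?f v \<in> {1..N}"
      using K N by (cases rule: zero_lift_map_cases[OF disj, of v n N]) auto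
  qed
  have "realizes N n ?w S"
    by (simp add: realizes_def vectors_def S_def)
  moreover have "n < N"
    using N by simp
  ultimately have "S \<in> H n"
    unfolding H_def using weight_map_contract[OF w] by blast
  moreover have "S I = S' (\<Union>i\<in>I. F i)" if I: "I \<subseteq> K" "I \<noteq> {}" for I
  proof -
    have I_index: "I \<in> index_sets n"
      using I K by (auto simp: index_sets_def)
    have "(\<Union>i\<in>I. F i) \<subseteq> {1..n + 1}" "(\<Union>i\<in>I. F i) \<noteq> {}"
      using I F by blast+
    then have J_index: "(\<Union>i\<in>I. F i) \<in> index_sets (n + 1)"
      by (simp add: index_sets_def)
    \<comment> \<open>The minimum for \<open>I\<close> in the contracted graph and the one for the
      union of blocks in the original graph range over the same set of values.\<close>
    have "{cut_weight N ?w W | W. W \<subseteq> {1..N - 1} \<and> W \<inter> {1..n} = I} =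
        cut_weight N w ` ?pre ` {W. W \<subseteq> {1..N - 1} \<and> W \<inter> {1..n} = I}"
      by (simp only: cut_weight_contract[OF f] image_image setcompr_eq_image)
    also have "\<dots> = cut_weight N w ` {W. W \<subseteq> {1..N - 1} \<and> W \<inter> {1..n + 1} = (\<Union>i\<in>I. F i)}"
      using zero_lift_cuts[OF disj K _ N I(1)] F by simp
    also have "\<dots> = {cut_weight N w W | W. W \<subseteq> {1..N - 1} \<and> W \<inter> {1..n + 1} = (\<Union>i\<in>I. F i)}"
      by blast
    finally show ?thesis
      using r I_index J_index unfolding realizes_def S_def by simp
  qed
  ultimately show ?thesis
    by (intro bexI[of _ S] allI impI) simp_all
qed

theorem proposition6:
  fixes n :: nat and q q' :: "nat set \<Rightarrow> real"
  assumes "n \<ge> 1"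
    and "q \<in> vectors n"
    and "valid_ineq n q"
    and "is_zero_lift n q q'"
  shows "valid_ineq (n + 1) q'"
  unfolding valid_ineq_def
proof
  fix S' assume S': "S' \<in> H (n + 1)"
  let ?K = "terminals n q"
  let ?A = "{I. I \<in> index_sets n \<and> q I \<noteq> 0}"
  obtain F where F: "\<forall>i\<in>?K. F i \<subseteq> {1..n + 1} \<and> F i \<noteq> {}"
    and disj: "disjoint_family_on F ?K" and q': "q' = zero_lift_by n F q"
    using assms(4) unfolding is_zero_lift_def by (elim exE conjE)
  have K: "?K \<subseteq> {1..n}"
    by (auto simp: terminals_def)
  obtain S where S: "S \<in> H n" and
    eq: "\<forall>I. I \<subseteq> ?K \<and> I \<noteq> {} \<longrightarrow> S I = S' (\<Union>i\<in>I. F i)"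
    using zero_lift_preimage[OF S' disj K bspec[OF F]] by blast
  \<comment> \<open>Every index with a nonzero coefficient consists of appearing terminals, so
    control of \<open>S\<close> on subsets of \<open>?K\<close> suffices.\<close>
  have "I \<subseteq> ?K" "I \<noteq> {}" if "I \<in> ?A" for I
    using that by (auto simp: terminals_def index_sets_def)
  then have "(\<Sum>I\<in>?A. q I * S' (\<Union>i\<in>I. F i)) = (\<Sum>I\<in>?A. q I * S I)"
    using eq by (intro sum.cong) simp_all
  also have "\<dots> = (\<Sum>I\<in>index_sets n. q I * S I)"
    by (rule sum.mono_neutral_left) (auto simp: finite_index_sets)
  also have "\<dots> \<ge> 0"
    using assms(3) S unfolding valid_ineq_def by blast
  finally show "(\<Sum>J\<in>index_sets (n + 1). q' J * S' J) \<ge> 0"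
    unfolding q' zero_lift_by_sum[OF F] .
qed

end
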